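(* For all $L$-formulas $\alpha,\beta$: $\alpha\vdash\beta$ is valid in all linearly ordered Routley IFs iff $\alpha\vdash\beta\in\mathsf{LinDLLR}$.
   Context: Let $L$ be the set of formulas built from a set $At$ of atomic formulas with $\wedge,\vee,\neg$; an $L$-pair is written $\alpha\vdash\beta$. For $n\in\mathbb{N}$, $\neg^n\alpha$ is $\alpha$ preceded by $n$ negations ($\neg^0\alpha=\alpha$). $\mathsf{LinDLLR}$ is the set of $L$-pairs derivable in the system with, for all formulas $\alpha,\beta,\gamma$, the axioms $\alpha\vdash\alpha$; $\alpha\wedge\beta\vdash\alpha$; $\alpha\wedge\beta\vdash\beta$; $\alpha\vdash\alpha\vee\beta$; $\beta\vdash\alpha\vee\beta$; $\alpha\wedge(\beta\vee\gamma)\vdash(\alpha\wedge\beta)\vee(\alpha\wedge\gamma)$; $\neg(\alpha\wedge\beta)\vdash\neg\alpha\vee\neg\beta$; $\neg\alpha\wedge\neg\beta\vdash\neg(\alpha\vee\beta)$; and, for every natural number $k\ge 0$, (L1) $\alpha\wedge\neg^{2k}\beta\vdash\neg^{2k}\alpha\vee\beta$ and (L2) $\alpha\wedge\neg^{2k+1}\alpha\vdash\beta\vee\neg^{2k+1}\beta$; and the rules: from $\alpha\vdash\beta$ and $\beta\vdash\gamma$ infer $\alpha\vdash\gamma$; from $\alpha\vdash\beta$ and $\alpha\vdash\gamma$ infer $\alpha\vdash\beta\wedge\gamma$; from $\alpha\vdash\gamma$ and $\beta\vdash\gamma$ infer $\alpha\vee\beta\vdash\gamma$; from $\alpha\vdash\beta$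 infer $\neg\beta\vdash\neg\alpha$. A Routley IF is a structure $\langle S,\circ,*,i,e\rangle$ where $S$ is a nonempty set, $\circ$ is an associative, commutative, idempotent binary operation on $S$, $*:S\to S$, and $i\neq e$ are elements of $S$ such that: $s\circ i=s$ and $s\circ e=e$ for all $s$; if $e=t\circ u$ then $e=t$ or $e=u$; and, writing $s\le t$ iff $s\circ t=s$: $i^*=e$ and $e^*=i$; $t\le u$ implies $u^*\le t^*$; for all $t,u$, $(t\circ u)^*\le t^*$ or $(t\circ u)^*\le u^*$. It is linearly ordered if $\le$ is a linear order. A proper filter is $F\subseteq S$ with $i\in F$, $e\notin F$, and $t\circ u\in F$ iff $t\in F$ and $u\in F$. A Routley IM is a Routley IF with a valuation $V$ assigning a proper filter to each atom. Support: $s\Vdash p$ iff $s\in V(p)$; $s\Vdash\alpha\wedge\beta$ iff $s\Vdash\alpha$ and $s\Vdash\beta$; $s\Vdash\alpha\vee\beta$ iff there are $t,u$ with $t\Vdash\alpha$, $u\Vdash\beta$, $t\circ u\le s$; $s\Vdash\neg\alpha$ iff $s^*\nVdash\alpha$. $\alpha\vdash\beta$ is valid in a Routley IF if in every Routley IM based on it every state supporting $\alpha$ supports $\beta$; it is valid in a class if valid in every member. *)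

theory Defs
  imports Main
begin

datatype 'a fm =
    Atom 'a
  | Neg "'a fm"  ("\<^bold>\<not> _" [70] 70)
  | Conj "'a fm" "'a fm"  (infixr "\<^bold>\<and>" 68)
  | Disj "'a fm" "'a fm"  (infixr "\<^bold>\<or>" 66)

text \<open>The pair \<open>(\<alpha>, \<beta>)\<close> stands for the sequent \<open>\<alpha> \<turnstile> \<beta>\<close>;
  \<open>(Neg ^^ n) \<alpha>\<close> is \<open>\<alpha>\<close> preceded by \<open>n\<close> negations.\<close>

inductive_set LinDLLR :: "('a fm \<times> 'a fm) set" where
  refl: "(\<alpha>, \<alpha>) \<in> LinDLLR"
| conjE1: "(\<alpha> \<^bold>\<and> \<beta>, \<alpha>) \<in> LinDLLR"
| conjE2: "(\<alpha> \<^bold>\<and> \<beta>, \<beta>) \<in> LinDLLR"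
| disjI1: "(\<alpha>, \<alpha> \<^bold>\<or> \<beta>) \<in> LinDLLR"
| disjI2: "(\<beta>, \<alpha> \<^bold>\<or> \<beta>) \<in> LinDLLR"
| distrib: "(\<alpha> \<^bold>\<and> (\<beta> \<^bold>\<or> \<gamma>), (\<alpha> \<^bold>\<and> \<beta>) \<^bold>\<or> (\<alpha> \<^bold>\<and> \<gamma>)) \<in> LinDLLR"
| neg_conj: "(\<^bold>\<not> (\<alpha> \<^bold>\<and> \<beta>), \<^bold>\<not> \<alpha> \<^bold>\<or> \<^bold>\<not> \<beta>) \<in> LinDLLR"
| neg_disj: "(\<^bold>\<not> \<alpha> \<^bold>\<and> \<^bold>\<not> \<beta>, \<^bold>\<not> (\<alpha> \<^bold>\<or> \<beta>)) \<in> LinDLLR"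
| L1: "(\<alpha> \<^bold>\<and> (Neg ^^ (2 * k)) \<beta>, (Neg ^^ (2 * k)) \<alpha> \<^bold>\<or> \<beta>) \<in> LinDLLR"
| L2: "(\<alpha> \<^bold>\<and> (Neg ^^ (2 * k + 1)) \<alpha>, \<beta> \<^bold>\<or> (Neg ^^ (2 * k + 1)) \<beta>) \<in> LinDLLR"
| cut: "\<lbrakk>(\<alpha>, \<beta>) \<in> LinDLLR; (\<beta>, \<gamma>) \<in> LinDLLR\<rbrakk> \<Longrightarrow> (\<alpha>, \<gamma>) \<in> LinDLLR"
| conjI: "\<lbrakk>(\<alpha>, \<beta>) \<in> LinDLLR; (\<alpha>, \<gamma>) \<in> LinDLLR\<rbrakk> \<Longrightarrow> (\<alpha>, \<beta> \<^bold>\<and> \<gamma>) \<in> LinDLLR"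
| disjE: "\<lbrakk>(\<alpha>, \<gamma>) \<in> LinDLLR; (\<beta>, \<gamma>) \<in> LinDLLR\<rbrakk> \<Longrightarrow> (\<alpha> \<^bold>\<or> \<beta>, \<gamma>) \<in> LinDLLR"
| contrapos: "(\<alpha>, \<beta>) \<in> LinDLLR \<Longrightarrow> (\<^bold>\<not> \<beta>, \<^bold>\<not> \<alpha>) \<in> LinDLLR"

text \<open>Frames have an explicit carrier \<open>S\<close> inside the type \<open>'s\<close>; the operations
  are unconstrained outside \<open>S\<close>.\<close>

locale routley_structure =
  fixes S :: "'s set"
    and comp :: "'s \<Rightarrow> 's \<Rightarrow> 's"  (infixl "\<odot>" 70)
    and star :: "'s \<Rightarrow> 's"
    and i :: 's
    and e :: 's
begin

definition le :: "'s \<Rightarrow> 's \<Rightarrow> bool"  (infix "\<preceq>" 50) where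
  "s \<preceq> t \<longleftrightarrow> s \<odot> t = s"

definition proper_filter :: "'s set \<Rightarrow> bool" where
  "proper_filter F \<longleftrightarrow> F \<subseteq> S \<and> i \<in> F \<and> e \<notin> F \<and>
     (\<forall>t\<in>S. \<forall>u\<in>S. t \<odot> u \<in> F \<longleftrightarrow> t \<in> F \<and> u \<in> F)"

definition valuation :: "('a \<Rightarrow> 's set) \<Rightarrow> bool" where
  "valuation V \<longleftrightarrow> (\<forall>p. proper_filter (V p))"

primrec supports :: "('a \<Rightarrow> 's set) \<Rightarrow> 's \<Rightarrow> 'a fm \<Rightarrow> bool" where
  "supports V s (Atom p) \<longleftrightarrow> s \<in> V p"
| "supports V s (\<^bold>\<not> \<alpha>) \<longleftrightarrow> \<not> supports V (star s) \<alpha>"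
| "supports V s (\<alpha> \<^bold>\<and> \<beta>) \<longleftrightarrow> supports V s \<alpha> \<and> supports V s \<beta>"
| "supports V s (\<alpha> \<^bold>\<or> \<beta>) \<longleftrightarrow>
     (\<exists>t\<in>S. \<exists>u\<in>S. supports V t \<alpha> \<and> supports V u \<beta> \<and> t \<odot> u \<preceq> s)"

definition valid :: "'a fm \<Rightarrow> 'a fm \<Rightarrow> bool" where
  "valid \<alpha> \<beta> \<longleftrightarrow>
     (\<forall>V. valuation V \<longrightarrow> (\<forall>s\<in>S. supports V s \<alpha> \<longrightarrow> supports V s \<beta>))"

end

locale routley_IF = routley_structure +
  assumes comp_closed: "\<lbrakk>s \<in> S; t \<in> S\<rbrakk> \<Longrightarrow> s \<odot> t \<in> S"
    and star_closed: "s \<in> S \<Longrightarrow> star s \<in> S"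
    and i_closed: "i \<in> S"
    and e_closed: "e \<in> S"
    and comp_assoc: "\<lbrakk>s \<in> S; t \<in> S; u \<in> S\<rbrakk> \<Longrightarrow> (s \<odot> t) \<odot> u = s \<odot> (t \<odot> u)"
    and comp_commute: "\<lbrakk>s \<in> S; t \<in> S\<rbrakk> \<Longrightarrow> s \<odot> t = t \<odot> s"
    and comp_idem: "s \<in> S \<Longrightarrow> s \<odot> s = s"
    and i_neq_e: "i \<noteq> e"
    and comp_i: "s \<in> S \<Longrightarrow> s \<odot> i = s"
    and comp_e: "s \<in> S \<Longrightarrow> s \<odot> e = e"
    and e_prime: "\<lbrakk>t \<in> S; u \<in> S; e = t \<odot> u\<rbrakk> \<Longrightarrow> e = t \<or> e = u"
    and star_i: "star i = e"
    and star_e: "star e = i"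
    and star_antitone: "\<lbrakk>t \<in> S; u \<in> S; t \<preceq> u\<rbrakk> \<Longrightarrow> star u \<preceq> star t"
    and star_comp: "\<lbrakk>t \<in> S; u \<in> S\<rbrakk> \<Longrightarrow> star (t \<odot> u) \<preceq> star t \<or> star (t \<odot> u) \<preceq> star u"

locale linear_routley_IF = routley_IF +
  assumes linear: "linear_order_on S {(s, t). s \<in> S \<and> t \<in> S \<and> s \<preceq> t}"

text \<open>HOL cannot quantify over all types inside a formula, so validity in the class of
  linearly ordered frames is relative to a universe \<open>'s\<close> from which carriers are drawn.\<close>

definition lin_valid :: "'s itself \<Rightarrow> 'a fm \<Rightarrow> 'a fm \<Rightarrow> bool" where
  "lin_valid _ \<alpha> \<beta> \<longleftrightarrow>
     (\<forall>(S :: 's set) comp star i e.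
        linear_routley_IF S comp star i e \<longrightarrow> routley_structure.valid S comp star i e \<alpha> \<beta>)"

end

theory Submission
  imports Defs "HOL-Library.Countable_Set"
begin

text \<open>In a linearly ordered frame the fusion is the minimum and \<open>i\<close> supports every formula, so
  disjunction is evaluated classically at each state, and \<open>\<not>\<^sup>n\<close> at \<open>s\<close> looks at the \<open>n\<close>-th
  iterate of \<open>*\<close> at \<open>s\<close>. The axioms L1 and L2 then say exactly that \<open>s\<close> is comparable with
  its even and odd iterates, respectively.

  Conversely, if \<open>\<alpha> \<turnstile> \<beta>\<close> is not derivable, choose a prime theory \<open>P\<close> with \<open>\<alpha> \<in> P\<close>, \<open>\<beta> \<notin> P\<close>.
  By L1 and L2, \<open>P\<close> and its images under the iterates of \<open>P\<^sup>* = {\<gamma>. \<not>\<gamma> \<notin> P}\<close> form a chain;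
  together with the empty and the full theory it is a countable linearly ordered frame refuting
  \<open>\<alpha> \<turnstile> \<beta>\<close>. Being countable, it can be copied into any infinite universe.\<close>

subsection \<open>Soundness\<close>

context linear_routley_IF
begin

lemma le_total:
  assumes "s \<in> S" "t \<in> S"
  shows "s \<preceq> t \<or> t \<preceq> s"
  using linear assms comp_idem[of s]
  by (cases "s = t") (auto simp: linear_order_on_def total_on_def le_def)

lemma le_trans:
  assumes "s \<in> S" "t \<in> S" "u \<in> S" "s \<preceq> t" "t \<preceq> u"
  shows "s \<preceq> u"
  using assms comp_assoc unfolding le_def by metis

lemma star_iterate_closed: "s \<in> S \<Longrightarrow> (star ^^ n) s \<in> S"
  by (induction n) (simp_all add: star_closed)

text \<open>The claims for \<open>i\<close> and \<open>e\<close> go through one joint induction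
  because \<open>star\<close> swaps the two states in the negation case. Primeness of
  \<open>e\<close> keeps it from supporting a disjunction.\<close>

lemma supports_i_e:
  assumes "valuation V"
  shows "supports V i \<phi> \<and> \<not> supports V e \<phi>"
proof (induction \<phi>)
  case (Atom p)
  then show ?case using assms by (simp add: valuation_def proper_filter_def)
next
  case (Disj \<phi> \<psi>)
  have "e = t \<or> e = u" if "t \<in> S" "u \<in> S" "t \<odot> u \<preceq> e" for t u
  proof -
    have "t \<odot> u = e"
      using that comp_e[of "t \<odot> u"] comp_closed unfolding le_def by simp
    then show ?thesis using e_prime that by blast
  qed
  then have "\<not> supports V e (\<phi> \<^bold>\<or> \<psi>)" using Disj by auto
  moreover have "i \<odot> i \<preceq> i" by (simp add: le_def comp_idem i_closed)
  ultimately show ?case using Disj i_closed by auto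
qed (simp_all add: star_i star_e)

lemma supports_mono:
  assumes "valuation V" "s \<in> S" "t \<in> S" "s \<preceq> t" "supports V s \<phi>"
  shows "supports V t \<phi>"
  using assms(2-)
proof (induction \<phi> arbitrary: s t)
  case (Atom p)
  then have "s \<odot> t \<in> V p" by (simp add: le_def)
  then show ?case
    using assms(1) Atom by (simp add: valuation_def proper_filter_def)
next
  case (Neg \<phi>)
  from Neg.prems have "star t \<preceq> star s" "star s \<in> S" "star t \<in> S"
    by (simp_all add: star_antitone star_closed)
  with Neg show ?case by auto
next
  case (Conj \<phi> \<psi>)
  then show ?case by (meson supports.simps(3))
next
  case (Disj \<phi> \<psi>)
  then obtain u v where uv: "u \<in> S" "v \<in> S" "supports V u \<phi>" "supports V v \<psi>" "u \<odot> v \<preceq> s"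
    by auto
  moreover have "u \<odot> v \<preceq> t"
    using uv Disj.prems le_trans[of "u \<odot> v" s t] comp_closed by blast
  ultimately show ?case by auto
qed

lemma supports_Disj_iff:
  assumes V: "valuation V" and s: "s \<in> S"
  shows "supports V s (\<phi> \<^bold>\<or> \<psi>) \<longleftrightarrow> supports V s \<phi> \<or> supports V s \<psi>"
proof
  assume "supports V s (\<phi> \<^bold>\<or> \<psi>)"
  then obtain t u where tu: "t \<in> S" "u \<in> S" "supports V t \<phi>" "supports V u \<psi>" "t \<odot> u \<preceq> s"
    by auto
  have "t \<odot> u = t \<or> t \<odot> u = u"
    using le_total[OF tu(1,2)] comp_commute[OF tu(1,2)] unfolding le_def by auto
  then have "t \<preceq> s \<or> u \<preceq> s" using tu(5) by auto
  then show "supports V s \<phi> \<or> supports V s \<psi>"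
    using supports_mono[OF V] tu s by blast
next
  \<comment> \<open>\<open>i\<close> supports every formula and is neutral for fusion, so it serves
    as witness for the other disjunct.\<close>
  have "s \<odot> i \<preceq> s" "i \<odot> s \<preceq> s"
    using comp_i comp_commute[of i s] comp_idem s i_closed by (simp_all add: le_def)
  moreover assume "supports V s \<phi> \<or> supports V s \<psi>"
  ultimately show "supports V s (\<phi> \<^bold>\<or> \<psi>)"
    using supports_i_e[OF V] s i_closed by auto
qed

lemma supports_Neg_iterate:
  "supports V s ((Neg ^^ n) \<phi>) \<longleftrightarrow>
    (if even n then supports V ((star ^^ n) s) \<phi> else \<not> supports V ((star ^^ n) s) \<phi>)"
  by (induction n arbitrary: s) (simp_all add: funpow_swap1[of star])

lemma soundness:
  assumes "(\<phi>, \<psi>) \<in> LinDLLR" "valuation V" "s \<in> S" "supports V s \<phi>"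
  shows "supports V s \<psi>"
  using assms(1,3,4)
proof (induction arbitrary: s rule: LinDLLR.induct)
  \<comment> \<open>Let \<open>r = (star ^^ (2 * k)) s\<close>. If \<open>s \<preceq> r\<close>,
    then \<open>r\<close> inherits \<open>\<alpha>\<close>, which is the left disjunct at
    \<open>s\<close>; if \<open>r \<preceq> s\<close>, then \<open>s\<close> inherits
    \<open>\<beta>\<close>.\<close>
  case (L1 \<alpha> k \<beta>)
  then show ?case
    using le_total[of s "(star ^^ (2 * k)) s"] star_iterate_closed[of s "2 * k"]
      supports_mono[OF assms(2)]
    by (auto simp: supports_Disj_iff[OF assms(2)] supports_Neg_iterate simp del: supports.simps(4))
next
  \<comment> \<open>The odd iterate lacks \<open>\<alpha>\<close>, so it lies below
    \<open>s\<close>. If \<open>s\<close> lacks \<open>\<beta>\<close>, then so does the iterate,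
    which is the right disjunct at \<open>s\<close>.\<close>
  case (L2 \<alpha> k \<beta>)
  then show ?case
    using le_total[of s "(star ^^ (2 * k + 1)) s"] star_iterate_closed[of s "2 * k + 1"]
      supports_mono[OF assms(2)]
    by (auto simp: supports_Disj_iff[OF assms(2)] supports_Neg_iterate
        simp del: supports.simps(4) funpow.simps)
qed (auto simp: supports_Disj_iff[OF assms(2)] star_closed simp del: supports.simps(4))

end

subsection \<open>Prime theories\<close>

definition theory_of :: "'a fm set \<Rightarrow> bool" where
  "theory_of P \<longleftrightarrow> (\<forall>\<phi> \<psi>. (\<phi>, \<psi>) \<in> LinDLLR \<longrightarrow> \<phi> \<in> P \<longrightarrow> \<psi> \<in> P) \<and>
     (\<forall>\<phi> \<psi>. \<phi> \<in> P \<longrightarrow> \<psi> \<in> P \<longrightarrow> \<phi> \<^bold>\<and> \<psi> \<in> P)"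

definition prime_theory :: "'a fm set \<Rightarrow> bool" where
  "prime_theory P \<longleftrightarrow> theory_of P \<and> (\<forall>\<phi> \<psi>. \<phi> \<^bold>\<or> \<psi> \<in> P \<longrightarrow> \<phi> \<in> P \<or> \<psi> \<in> P)"

definition star_theory :: "'a fm set \<Rightarrow> 'a fm set" where
  "star_theory P = {\<phi>. \<^bold>\<not> \<phi> \<notin> P}"

lemma theory_of_derivable: "theory_of P \<Longrightarrow> (\<phi>, \<psi>) \<in> LinDLLR \<Longrightarrow> \<phi> \<in> P \<Longrightarrow> \<psi> \<in> P"
  unfolding theory_of_def by blast

lemma theory_of_conj: "theory_of P \<Longrightarrow> \<phi> \<^bold>\<and> \<psi> \<in> P \<longleftrightarrow> \<phi> \<in> P \<and> \<psi> \<in> P"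
  unfolding theory_of_def using LinDLLR.conjE1 LinDLLR.conjE2 by blast

lemma prime_theory_disj: "prime_theory P \<Longrightarrow> \<phi> \<^bold>\<or> \<psi> \<in> P \<longleftrightarrow> \<phi> \<in> P \<or> \<psi> \<in> P"
  unfolding prime_theory_def theory_of_def using LinDLLR.disjI1 LinDLLR.disjI2 by blast

lemma prime_theory_trivial: "prime_theory {}" "prime_theory UNIV"
  by (simp_all add: prime_theory_def theory_of_def)

section \<open>The Routley star on prime theories\<close>

lemma star_theory_trivial: "star_theory {} = UNIV" "star_theory UNIV = {}"
  by (auto simp: star_theory_def)

text \<open>Contraposition gives upward closure, \<open>neg_conj\<close> with primeness of
  \<open>P\<close> gives closure under conjunction, and \<open>neg_disj\<close> turns closure of
  \<open>P\<close> under conjunction into primeness.\<close>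

lemma prime_theory_star:
  assumes "prime_theory P"
  shows "prime_theory (star_theory P)"
proof -
  have th: "theory_of P" using assms by (simp add: prime_theory_def)
  show ?thesis
    unfolding prime_theory_def theory_of_def star_theory_def
    using theory_of_derivable[OF th LinDLLR.contrapos] theory_of_derivable[OF th LinDLLR.neg_conj]
      theory_of_derivable[OF th LinDLLR.neg_disj] theory_of_conj[OF th] prime_theory_disj[OF assms]
    by blast
qed

lemma prime_theory_star_iterate: "prime_theory P \<Longrightarrow> prime_theory ((star_theory ^^ n) P)"
  by (induction n) (simp_all add: prime_theory_star)

lemma mem_star_iterate:
  "\<phi> \<in> (star_theory ^^ n) P \<longleftrightarrow>
    (if even n then (Neg ^^ n) \<phi> \<in> P else (Neg ^^ n) \<phi> \<notin> P)"
  by (induction n arbitrary: \<phi>) (simp_all add: star_theory_def funpow_swap1[of Neg])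

text \<open>Fix \<open>\<psi>\<close> in the iterate but outside \<open>P\<close>. For even
  \<open>n\<close>, L1 yields a disjunction in \<open>P\<close> whose right side
  \<open>\<psi>\<close> is excluded. For odd \<open>n\<close>, if \<open>P\<close> contained
  \<open>\<phi>\<close> and its \<open>n\<close>-fold negation, L2 would put \<open>\<psi>\<close>
  or its \<open>n\<close>-fold negation into \<open>P\<close>, yet both are outside.\<close>

lemma star_iterate_comparable:
  assumes P: "prime_theory P"
  shows "P \<subseteq> (star_theory ^^ n) P \<or> (star_theory ^^ n) P \<subseteq> P"
proof -
  have th: "theory_of P" using P by (simp add: prime_theory_def)
  show ?thesis
  proof (rule disjCI)
    assume not_sub: "\<not> (star_theory ^^ n) P \<subseteq> P"
    show "P \<subseteq> (star_theory ^^ n) P"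
    proof (cases "even n")
      case True
      then obtain k where n: "n = 2 * k" by (rule evenE)
      from not_sub True obtain \<psi> where \<psi>: "(Neg ^^ n) \<psi> \<in> P" "\<psi> \<notin> P"
        by (simp add: subset_iff mem_star_iterate) blast
      have "(Neg ^^ n) \<phi> \<in> P" if "\<phi> \<in> P" for \<phi>
        using that \<psi> theory_of_derivable[OF th LinDLLR.L1[of \<phi> k \<psi>]]
        unfolding n theory_of_conj[OF th] prime_theory_disj[OF P] by blast
      with True show ?thesis by (simp add: mem_star_iterate subset_iff)
    next
      case False
      then obtain k where n: "n = 2 * k + 1" by (rule oddE)
      from not_sub False obtain \<psi> where \<psi>: "(Neg ^^ n) \<psi> \<notin> P" "\<psi> \<notin> P"
        by (simp add: subset_iff mem_star_iterate) blast
      have "(Neg ^^ n) \<phi> \<notin> P" if "\<phi> \<in> P" for \<phi>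
        using that \<psi> theory_of_derivable[OF th LinDLLR.L2[of \<phi> k \<psi>]]
        unfolding n theory_of_conj[OF th] prime_theory_disj[OF P] by blast
      with False show ?thesis by (simp add: mem_star_iterate subset_iff)
    qed
  qed
qed

text \<open>A later iterate is an iterate of the earlier one, which is again prime, so comparison
  with the starting point suffices.\<close>

lemma star_orbit_chain:
  assumes "prime_theory P"
  shows "(star_theory ^^ m) P \<subseteq> (star_theory ^^ n) P \<or> (star_theory ^^ n) P \<subseteq> (star_theory ^^ m) P"
proof -
  have aux: "(star_theory ^^ m) P \<subseteq> (star_theory ^^ n) P \<or> (star_theory ^^ n) P \<subseteq> (star_theory ^^ m) P"
    if "m \<le> n" for m n
    using star_iterate_comparable[OF prime_theory_star_iterate[OF assms, of m], of "n - m"] that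
    by (simp flip: funpow_add[THEN fun_cong, unfolded comp_def])
  show ?thesis using aux[of m n] aux[of n m] by (meson nat_le_linear)
qed

section \<open>Prime extensions by Zorn's lemma\<close>

lemma conj_weaken:
  "((\<mu> \<^bold>\<and> \<nu>) \<^bold>\<and> \<phi>, \<mu> \<^bold>\<and> \<phi>) \<in> LinDLLR" "((\<mu> \<^bold>\<and> \<nu>) \<^bold>\<and> \<phi>, \<nu> \<^bold>\<and> \<phi>) \<in> LinDLLR"
  by (rule LinDLLR.conjI[OF LinDLLR.cut[OF LinDLLR.conjE1 LinDLLR.conjE1] LinDLLR.conjE2]
      LinDLLR.conjI[OF LinDLLR.cut[OF LinDLLR.conjE1 LinDLLR.conjE2] LinDLLR.conjE2])+

text \<open>For nonempty \<open>M\<close> this is the theory generated by \<open>M\<close> and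
  \<open>\<phi>\<close>; a single premise from \<open>M\<close> suffices because premises can be
  conjoined.\<close>

lemma theory_of_adjoin:
  assumes "theory_of M"
  shows "theory_of {\<chi>. \<exists>\<mu>\<in>M. (\<mu> \<^bold>\<and> \<phi>, \<chi>) \<in> LinDLLR}"
  unfolding theory_of_def
proof (intro HOL.conjI allI impI)
  fix \<chi> \<psi>
  assume "\<chi> \<in> {\<chi>. \<exists>\<mu>\<in>M. (\<mu> \<^bold>\<and> \<phi>, \<chi>) \<in> LinDLLR}" "\<psi> \<in> {\<chi>. \<exists>\<mu>\<in>M. (\<mu> \<^bold>\<and> \<phi>, \<chi>) \<in> LinDLLR}"
  then obtain \<mu> \<nu> where \<mu>: "\<mu> \<in> M" "(\<mu> \<^bold>\<and> \<phi>, \<chi>) \<in> LinDLLR" and \<nu>: "\<nu> \<in> M" "(\<nu> \<^bold>\<and> \<phi>, \<psi>) \<in> LinDLLR"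
    by blast
  have "((\<mu> \<^bold>\<and> \<nu>) \<^bold>\<and> \<phi>, \<chi> \<^bold>\<and> \<psi>) \<in> LinDLLR"
    using LinDLLR.conjI[OF LinDLLR.cut[OF conj_weaken(1) \<mu>(2)] LinDLLR.cut[OF conj_weaken(2) \<nu>(2)]] .
  moreover have "\<mu> \<^bold>\<and> \<nu> \<in> M" using \<mu>(1) \<nu>(1) assms by (simp add: theory_of_conj)
  ultimately show "\<chi> \<^bold>\<and> \<psi> \<in> {\<chi>. \<exists>\<mu>\<in>M. (\<mu> \<^bold>\<and> \<phi>, \<chi>) \<in> LinDLLR}" by blast
qed (use LinDLLR.cut in blast)

text \<open>As in the prime filter theorem, a theory maximal among those containing
  \<open>\<alpha>\<close> and omitting \<open>\<beta>\<close> is prime.\<close>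

lemma prime_theory_extension:
  assumes nd: "(\<alpha>, \<beta>) \<notin> LinDLLR"
  obtains P where "prime_theory P" "\<alpha> \<in> P" "\<beta> \<notin> P"
proof -
  define A where "A = {P. theory_of P \<and> \<alpha> \<in> P \<and> \<beta> \<notin> P}"
  have "{\<phi>. (\<alpha>, \<phi>) \<in> LinDLLR} \<in> A"
    using nd LinDLLR.refl LinDLLR.cut LinDLLR.conjI unfolding A_def theory_of_def by blast
  then have "A \<noteq> {}" by blast
  moreover have "\<Union>C \<in> A" if "C \<noteq> {}" "subset.chain A C" for C
  proof -
    have C: "\<And>P. P \<in> C \<Longrightarrow> theory_of P \<and> \<alpha> \<in> P \<and> \<beta> \<notin> P"
      "\<And>P Q. P \<in> C \<Longrightarrow> Q \<in> C \<Longrightarrow> P \<subseteq> Q \<or> Q \<subseteq> P"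
      using that unfolding A_def subset.chain_def by auto
    have "\<phi> \<^bold>\<and> \<psi> \<in> \<Union>C" if "P \<in> C" "Q \<in> C" "\<phi> \<in> P" "\<psi> \<in> Q" for P Q \<phi> \<psi>
      using C(2)[OF that(1,2)] C(1)[OF that(1)] C(1)[OF that(2)] that theory_of_conj by blast
    moreover have "\<psi> \<in> \<Union>C" if "(\<phi>, \<psi>) \<in> LinDLLR" "\<phi> \<in> \<Union>C" for \<phi> \<psi>
      using that C(1) theory_of_derivable by blast
    ultimately have "theory_of (\<Union>C)" unfolding theory_of_def by blast
    with C(1) \<open>C \<noteq> {}\<close> show ?thesis unfolding A_def by blast
  qed
  ultimately obtain M where M: "M \<in> A" and max: "\<And>X. X \<in> A \<Longrightarrow> M \<subseteq> X \<Longrightarrow> X = M"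
    using subset_Zorn_nonempty[of A] by metis
  have th: "theory_of M" and M\<alpha>: "\<alpha> \<in> M" and M\<beta>: "\<beta> \<notin> M" using M by (simp_all add: A_def)
  \<comment> \<open>Adjoining a formula outside \<open>M\<close> strictly enlarges it, so by
    maximality the new theory must contain \<open>\<beta>\<close>.\<close>
  have separate: "\<exists>\<mu>\<in>M. (\<mu> \<^bold>\<and> \<phi>, \<beta>) \<in> LinDLLR" if "\<phi> \<notin> M" for \<phi>
  proof (rule ccontr)
    let ?X = "{\<chi>. \<exists>\<mu>\<in>M. (\<mu> \<^bold>\<and> \<phi>, \<chi>) \<in> LinDLLR}"
    assume "\<not> ?thesis"
    moreover have sub: "M \<subseteq> ?X" using LinDLLR.conjE1 by blast
    ultimately have "?X \<in> A" using theory_of_adjoin[OF th] M\<alpha> unfolding A_def by blast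
    then have "?X = M" using max sub by blast
    then show False using that M\<alpha> LinDLLR.conjE2 by blast
  qed
  have "\<phi> \<in> M \<or> \<psi> \<in> M" if disj: "\<phi> \<^bold>\<or> \<psi> \<in> M" for \<phi> \<psi>
  proof (rule ccontr)
    assume "\<not> ?thesis"
    then obtain \<mu> \<nu> where \<mu>: "\<mu> \<in> M" "(\<mu> \<^bold>\<and> \<phi>, \<beta>) \<in> LinDLLR" and \<nu>: "\<nu> \<in> M" "(\<nu> \<^bold>\<and> \<psi>, \<beta>) \<in> LinDLLR"
      using separate by blast
    let ?\<kappa> = "\<mu> \<^bold>\<and> \<nu>"
    have "(?\<kappa> \<^bold>\<and> \<phi>, \<beta>) \<in> LinDLLR" "(?\<kappa> \<^bold>\<and> \<psi>, \<beta>) \<in> LinDLLR"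
      using LinDLLR.cut[OF conj_weaken(1) \<mu>(2)] LinDLLR.cut[OF conj_weaken(2) \<nu>(2)] .
    \<comment> \<open>Distributivity merges the two deductions of \<open>\<beta>\<close> into one
      from a member of \<open>M\<close>.\<close>
    then have "(?\<kappa> \<^bold>\<and> (\<phi> \<^bold>\<or> \<psi>), \<beta>) \<in> LinDLLR"
      by (rule LinDLLR.cut[OF LinDLLR.distrib LinDLLR.disjE])
    moreover have "?\<kappa> \<^bold>\<and> (\<phi> \<^bold>\<or> \<psi>) \<in> M" using \<mu>(1) \<nu>(1) disj th by (simp add: theory_of_conj)
    ultimately show False using M\<beta> theory_of_derivable[OF th] by blast
  qed
  then show ?thesis using that th M\<alpha> M\<beta> unfolding prime_theory_def by blast
qed

subsection \<open>The countermodel\<close>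

text \<open>A chain of prime theories that is closed under \<open>*\<close>, copied along an injection \<open>f\<close> whose
  left inverse on the chain is \<open>g\<close>.\<close>

locale theory_chain =
  fixes C :: "'a fm set set" and f :: "'a fm set \<Rightarrow> 's" and g :: "'s \<Rightarrow> 'a fm set"
  assumes prime: "P \<in> C \<Longrightarrow> prime_theory P"
    and chain: "\<lbrakk>P \<in> C; Q \<in> C\<rbrakk> \<Longrightarrow> P \<subseteq> Q \<or> Q \<subseteq> P"
    and star_mem: "P \<in> C \<Longrightarrow> star_theory P \<in> C"
    and empty_mem: "{} \<in> C"
    and UNIV_mem: "UNIV \<in> C"
    and g_f: "P \<in> C \<Longrightarrow> g (f P) = P"
begin

text \<open>Fusion as intersection makes the frame order inclusion; on a chain the result is one of
  the two arguments, so it stays in \<open>C\<close>.\<close>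

definition "frame_comp s t = f (g s \<inter> g t)"
definition "frame_star s = f (star_theory (g s))"

lemma Int_mem: "\<lbrakk>P \<in> C; Q \<in> C\<rbrakk> \<Longrightarrow> P \<inter> Q \<in> C"
  using chain by (metis inf.absorb1 inf.absorb2)

lemma f_eq_iff: "\<lbrakk>P \<in> C; Q \<in> C\<rbrakk> \<Longrightarrow> f P = f Q \<longleftrightarrow> P = Q"
  using g_f by metis

lemma g_frame_comp: "\<lbrakk>s \<in> f ` C; t \<in> f ` C\<rbrakk> \<Longrightarrow> g (frame_comp s t) = g s \<inter> g t"
  by (auto simp: frame_comp_def g_f Int_mem)

lemma g_frame_star: "s \<in> f ` C \<Longrightarrow> g (frame_star s) = star_theory (g s)"
  by (auto simp: frame_star_def g_f star_mem)

abbreviation "frame_le \<equiv> routley_structure.le frame_comp"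

lemma frame_le_iff: "\<lbrakk>P \<in> C; Q \<in> C\<rbrakk> \<Longrightarrow> frame_le (f P) (f Q) \<longleftrightarrow> P \<subseteq> Q"
  by (auto simp: routley_structure.le_def frame_comp_def g_f f_eq_iff Int_mem)

lemma star_theory_antitone: "P \<subseteq> Q \<Longrightarrow> star_theory Q \<subseteq> star_theory P"
  by (auto simp: star_theory_def)

lemma frame: "linear_routley_IF (f ` C) frame_comp frame_star (f UNIV) (f {})"
proof unfold_locales
  show "linear_order_on (f ` C) {(s, t). s \<in> f ` C \<and> t \<in> f ` C \<and> frame_le s t}"
    using chain
    by (auto simp: linear_order_on_def partial_order_on_def preorder_on_def refl_on_def trans_def
        antisym_def total_on_def frame_le_iff f_eq_iff)
next
  fix t u assume "t \<in> f ` C" "u \<in> f ` C"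
  then obtain P Q where PQ: "P \<in> C" "Q \<in> C" "t = f P" "u = f Q" by blast
  \<comment> \<open>The star of the fusion is thus the star of one argument. The same case split
    gives primeness of \<open>f {}\<close>.\<close>
  then have "frame_comp t u = f P \<or> frame_comp t u = f Q"
    using chain[of P Q] by (auto simp: frame_comp_def g_f Int_absorb1 Int_absorb2)
  then show "frame_le (frame_star (frame_comp t u)) (frame_star t) \<or>
      frame_le (frame_star (frame_comp t u)) (frame_star u)"
    using PQ by (auto simp: frame_star_def g_f frame_le_iff star_mem)
  show "f {} = t \<or> f {} = u" if "f {} = frame_comp t u"
    using that PQ chain[of P Q]
    by (auto simp: frame_comp_def g_f f_eq_iff Int_mem empty_mem Int_absorb1 Int_absorb2)
qed (auto simp: frame_comp_def frame_star_def g_f f_eq_iff Int_mem star_mem empty_mem UNIV_mem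
    frame_le_iff star_theory_antitone Int_ac star_theory_trivial)

text \<open>This brings in the classical disjunction clause \<open>supports_Disj_iff\<close>, on
  which \<open>truth\<close> relies.\<close>

sublocale linear_routley_IF "f ` C" frame_comp frame_star "f UNIV" "f {}"
  by (rule frame)

abbreviation "frame_valuation \<equiv> \<lambda>p. {s \<in> f ` C. Atom p \<in> g s}"

lemma valuation_frame: "valuation frame_valuation"
  unfolding valuation_def proper_filter_def
  by (auto simp: g_f UNIV_mem empty_mem frame_comp_def Int_mem)

text \<open>Negation holds by the choice of the star, conjunction by the theory laws, disjunction by
  primeness.\<close>

lemma truth: "s \<in> f ` C \<Longrightarrow> supports frame_valuation s \<phi> \<longleftrightarrow> \<phi> \<in> g s"
proof (induction \<phi> arbitrary: s)
  case (Neg \<phi>)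
  then show ?case using star_closed[of s] by (simp add: g_frame_star) (simp add: star_theory_def)
next
  case (Conj \<phi> \<psi>)
  then have "theory_of (g s)" using prime by (auto simp: g_f prime_theory_def)
  with Conj show ?case by (simp add: theory_of_conj)
next
  case (Disj \<phi> \<psi>)
  then have "prime_theory (g s)" using prime by (auto simp: g_f)
  with Disj show ?case
    by (simp add: supports_Disj_iff[OF valuation_frame] prime_theory_disj del: supports.simps(4))
qed simp

end

lemma countermodel:
  assumes inf: "infinite (UNIV :: 's set)" and nd: "(\<alpha>, \<beta>) \<notin> LinDLLR"
  shows "\<not> lin_valid TYPE('s) \<alpha> \<beta>"
proof -
  obtain P where P: "prime_theory P" "\<alpha> \<in> P" "\<beta> \<notin> P"
    using prime_theory_extension[OF nd] .
  \<comment> \<open>The star swaps \<open>{}\<close> and \<open>UNIV\<close> and shifts the orbit of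
    \<open>P\<close> by one, so \<open>C\<close> is closed under it.\<close>
  define C where "C = insert {} (insert UNIV (range (\<lambda>n. (star_theory ^^ n) P)))"
  have "countable C" unfolding C_def by simp
  moreover obtain h :: "nat \<Rightarrow> 's" where h: "inj h"
    using infinite_countable_subset[OF inf] by blast
  ultimately have inj: "inj_on (h \<circ> to_nat_on C) C"
    by (auto intro!: comp_inj_on inj_on_subset[OF h])
  define f where "f = h \<circ> to_nat_on C"
  interpret theory_chain C f "inv_into C f"
  proof
    show "prime_theory Q" if "Q \<in> C" for Q
      using that P(1) prime_theory_trivial prime_theory_star_iterate unfolding C_def by auto
    show "Q \<subseteq> R \<or> R \<subseteq> Q" if "Q \<in> C" "R \<in> C" for Q R
      using that star_orbit_chain[OF P(1)] unfolding C_def by blast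
    show "star_theory Q \<in> C" if "Q \<in> C" for Q
    proof -
      have "star_theory ((star_theory ^^ n) P) \<in> C" for n
        unfolding C_def using rangeI[of "\<lambda>n. (star_theory ^^ n) P" "Suc n"] by simp
      then show ?thesis using that star_theory_trivial by (auto simp: C_def)
    qed
    show "inv_into C f (f Q) = Q" if "Q \<in> C" for Q
      using that inj unfolding f_def by (rule inv_into_f_f[rotated])
  qed (simp_all add: C_def)
  have "P \<in> C" unfolding C_def using funpow_0[of star_theory P] by blast
  then have "supports frame_valuation (f P) \<alpha>" "\<not> supports frame_valuation (f P) \<beta>"
    using P truth g_f by auto
  then have "\<not> valid \<alpha> \<beta>"
    using valuation_frame \<open>P \<in> C\<close> unfolding valid_def by blast
  then show ?thesis using frame unfolding lin_valid_def by blast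
qed

theorem theorem1:
  fixes \<alpha> \<beta> :: "'a fm"
  assumes "infinite (UNIV :: 's set)"
  shows "lin_valid TYPE('s) \<alpha> \<beta> \<longleftrightarrow> (\<alpha>, \<beta>) \<in> LinDLLR"
proof
  assume "lin_valid TYPE('s) \<alpha> \<beta>"
  then show "(\<alpha>, \<beta>) \<in> LinDLLR" using countermodel[OF assms] by blast
next
  assume "(\<alpha>, \<beta>) \<in> LinDLLR"
  then show "lin_valid TYPE('s) \<alpha> \<beta>"
    unfolding lin_valid_def routley_structure.valid_def
    by (meson linear_routley_IF.soundness)
qed

end
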